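(* Let $r\ge 2$ be an integer. If $G$ is an $(r+1)$-clique-free graph of order $n$, then $$\gamma^{NN}_{s}(G)\ge-\frac{2r}{r-1}+\frac{2}{r-1}\sqrt{r^{2}+r(r-1)n}-n.$$ Furthermore, equality holds if and only if $G=H\circ \overline{K_{(r-1)p+1}}$ for some positive integer $p$, where $H$ is a complete $r$-partite graph with exactly $p$ vertices in each partite set.
   Context: All graphs are finite and simple. A graph is $(r+1)$-clique-free if it contains no complete subgraph $K_{r+1}$. For a vertex $v$, $N[v]=N(v)\cup\{v\}$; for $f:V(G)\to\mathbb{R}$ and $S\subseteq V(G)$, $f(S)=\sum_{v\in S}f(v)$. A nonnegative signed dominating function (NNSDF) of $G$ is a function $f:V(G)\to\{-1,1\}$ with $f(N[v])\ge 0$ for every $v\in V(G)$; $\gamma^{NN}_s(G)$ is the minimum of $f(V(G))$ over all NNSDFs $f$ of $G$. The corona $G_1\circ G_2$ is the graph formed from one copy of $G_1$ and $|V(G_1)|$ copies of $G_2$, where the $i$-th vertex of $G_1$ is joined to every vertex of the $i$-th copy of $G_2$. $\overline{K_m}$ denotes the edgeless graph on $m$ vertices. *)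

theory Defs
  imports Complex_Main "HOL-Library.FuncSet" "HOL-Library.Disjoint_Sets" "Graph_Theory.Graph_Theory"
begin

text \<open>
  A finite simple graph is a \<^locale>\<open>pair_graph\<close>: finite, loopless, and with a symmetric arc relation,
  so that an edge joining u and v is the pair of arcs (u, v) and (v, u).
\<close>

definition clique_free :: "nat \<Rightarrow> 'a pair_pre_digraph \<Rightarrow> bool" where
  "clique_free k G \<longleftrightarrow>
     \<not> (\<exists>H :: 'a pair_pre_digraph. subgraph (with_proj H) (with_proj G) \<and> K\<^bsub>k\<^esub> (with_proj H))"

definition nbhd :: "'a pair_pre_digraph \<Rightarrow> 'a \<Rightarrow> 'a set" where
  "nbhd G v = {u. (v, u) \<in> parcs G}"

definition closed_nbhd :: "'a pair_pre_digraph \<Rightarrow> 'a \<Rightarrow> 'a set" where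
  "closed_nbhd G v = nbhd G v \<union> {v}"

definition nnsdf :: "'a pair_pre_digraph \<Rightarrow> ('a \<Rightarrow> int) \<Rightarrow> bool" where
  "nnsdf G f \<longleftrightarrow> f \<in> pverts G \<rightarrow> {-1, 1} \<and> (\<forall>v \<in> pverts G. sum f (closed_nbhd G v) \<ge> 0)"

text \<open>
  For a finite graph the set below is finite (its members lie between minus the order and the order)
  and nonempty (the constant function 1 qualifies), so \<^const>\<open>Min\<close> is a genuine minimum.
\<close>

definition nnsd_number :: "'a pair_pre_digraph \<Rightarrow> int" where
  "nnsd_number G = Min {sum f (pverts G) | f. nnsdf G f}"

text \<open>In the corona, \<open>Inl i\<close> is the vertex i of G1, and \<open>Inr (i, x)\<close> is the vertex x of the i-th copy of G2.\<close>

definition corona :: "'a pair_pre_digraph \<Rightarrow> 'b pair_pre_digraph \<Rightarrow> ('a + 'a \<times> 'b) pair_pre_digraph" where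
  "corona G1 G2 = \<lparr>
     pverts = pverts G1 <+> (pverts G1 \<times> pverts G2),
     parcs = {(Inl u, Inl v) | u v. (u, v) \<in> parcs G1}
       \<union> {(Inr (i, x), Inr (i, y)) | i x y. i \<in> pverts G1 \<and> (x, y) \<in> parcs G2}
       \<union> {(Inl i, Inr (i, x)) | i x. i \<in> pverts G1 \<and> x \<in> pverts G2}
       \<union> {(Inr (i, x), Inl i) | i x. i \<in> pverts G1 \<and> x \<in> pverts G2} \<rparr>"

definition edgeless_graph :: "nat \<Rightarrow> nat pair_pre_digraph" where
  "edgeless_graph m = \<lparr> pverts = {..<m}, parcs = {} \<rparr>"

definition complete_multipartite :: "'a pair_pre_digraph \<Rightarrow> 'a set set \<Rightarrow> bool" where
  "complete_multipartite H P \<longleftrightarrow> pair_graph H \<and> partition_on (pverts H) P \<and>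
     parcs H = {(u, v). u \<in> pverts H \<and> v \<in> pverts H \<and> \<not> (\<exists>A \<in> P. u \<in> A \<and> v \<in> A)}"

text \<open>
  Complete r-partite with exactly p vertices in each part; meant for positive p, since
  the parts given by \<^const>\<open>partition_on\<close> are nonempty.
\<close>

definition balanced_complete_partite :: "nat \<Rightarrow> nat \<Rightarrow> 'a pair_pre_digraph \<Rightarrow> bool" where
  "balanced_complete_partite r p H \<longleftrightarrow>
     (\<exists>P. complete_multipartite H P \<and> card P = r \<and> (\<forall>A \<in> P. card A = p))"

end

theory Submission
  imports Defs
begin

text \<open>
  Let P and M be the sets of vertices with value 1 and -1, a = |P|, and D the sum of the degrees in G[P].
  Every vertex of M has a neighbour in P, and every u in P has at most deg_P(u) + 1 neighbours in M;
  counting the edges between P and M gives n \<le> D + 2a. By Turan's theorem r D \<le> (r - 1) a^2, and the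
  resulting quadratic inequality in a bounds the weight 2a - n from below. In the case of equality
  all these inequalities are tight: G[P] is a balanced complete r-partite graph, each vertex of M is
  a leaf attached to P, and each u in P carries exactly deg_P(u) + 1 leaves.
\<close>

section \<open>Double counting and Turan's theorem for symmetric relations\<close>

lemma sum_card_swap:
  assumes "finite A" "finite B" "sym R"
  shows "(\<Sum>a\<in>A. card (R `` {a} \<inter> B)) = (\<Sum>b\<in>B. card (R `` {b} \<inter> A))"
proof -
  have "(\<Sum>a\<in>A. \<Sum>b | b \<in> B \<and> (a, b) \<in> R. 1) = (\<Sum>b\<in>B. \<Sum>a | a \<in> A \<and> (a, b) \<in> R. (1::nat))"
    by (rule sum.swap_restrict[OF assms(1,2)])
  moreover have "{b. b \<in> B \<and> (a, b) \<in> R} = R `` {a} \<inter> B" for a by auto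
  moreover have "{a. a \<in> A \<and> (a, b) \<in> R} = R `` {b} \<inter> A" for b
    using assms(3) by (auto dest: symD)
  ultimately show ?thesis by simp
qed

text \<open>
  The induction removes the complement U of the neighbourhood W of a vertex of maximum degree:
  if V contains no clique of size k + 3, then W contains none of size k + 2, and in the case of equality
  U turns out to be one further part.
\<close>
theorem turan:
  fixes R :: "'a rel"
  assumes "finite V" "sym R" "irrefl R"
    and "\<forall>K\<subseteq>V. card K = k + 2 \<longrightarrow> \<not> pairwise (\<lambda>x y. (x, y) \<in> R) K"
  shows "(k + 1) * (\<Sum>v\<in>V. card (R `` {v} \<inter> V)) \<le> k * (card V)\<^sup>2 \<and>
    ((k + 1) * (\<Sum>v\<in>V. card (R `` {v} \<inter> V)) = k * (card V)\<^sup>2 \<longrightarrow> V \<noteq> {} \<longrightarrow>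
      (\<exists>P. partition_on V P \<and> card P = k + 1 \<and> (\<forall>A\<in>P. (k + 1) * card A = card V) \<and>
        (\<forall>u\<in>V. \<forall>v\<in>V. (u, v) \<in> R \<longleftrightarrow> \<not> (\<exists>A\<in>P. u \<in> A \<and> v \<in> A))))"
  using assms(1,4)
proof (induction k arbitrary: V)
  case 0
  have E: "(u, v) \<notin> R" if "u \<in> V" "v \<in> V" for u v
  proof
    assume uv: "(u, v) \<in> R"
    with assms(3) have "u \<noteq> v" by (auto simp: irrefl_def)
    then have "\<not> pairwise (\<lambda>x y. (x, y) \<in> R) {u, v}" using 0(2) that by simp
    then show False using uv assms(2) by (auto simp: pairwise_def dest: symD)
  qed
  have d: "card (R `` {v} \<inter> V) = 0" if "v \<in> V" for v
    using E that by (auto simp: card_eq_0_iff)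
  have "\<exists>P. partition_on V P \<and> card P = 0 + 1 \<and> (\<forall>A\<in>P. (0 + 1) * card A = card V) \<and>
        (\<forall>u\<in>V. \<forall>v\<in>V. (u, v) \<in> R \<longleftrightarrow> \<not> (\<exists>A\<in>P. u \<in> A \<and> v \<in> A))" if "V \<noteq> {}"
    using that E by (intro exI[of _ "{V}"]) (auto simp: partition_on_def)
  with d show ?case by simp
next
  case (Suc k)
  show ?case
  proof (cases "V = {}")
    case False
    define d where "d v = card (R `` {v} \<inter> V)" for v
    define \<Delta> where "\<Delta> = Max (d ` V)"
    have d_le: "d u \<le> \<Delta>" if "u \<in> V" for u
      using that Suc.prems(1) by (auto simp: \<Delta>_def)
    have "\<Delta> \<in> d ` V" unfolding \<Delta>_def using Suc.prems(1) False by (intro Max_in) auto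
    then obtain v where v: "v \<in> V" "d v = \<Delta>" by auto
    define W where "W = R `` {v} \<inter> V"
    define U where "U = V - W"
    have fin: "finite W" "finite U" and WV: "W \<subseteq> V" and cW: "card W = \<Delta>"
      using Suc.prems(1) v by (auto simp: W_def U_def d_def)
    have vU: "v \<in> U" using v assms(3) by (auto simp: U_def W_def irrefl_def)
    have cU: "card U + \<Delta> = card V"
      using card_Diff_subset[OF fin(1) WV] card_mono[OF Suc.prems(1) WV] cW by (simp add: U_def)
    define DW where "DW = (\<Sum>w\<in>W. card (R `` {w} \<inter> W))"
    \<comment> \<open>\<open>v\<close> is adjacent to all of \<open>W\<close>, so adding it to a
      clique in \<open>W\<close> gives a clique in \<open>V\<close> with one more vertex.\<close>
    have noK: "\<forall>K\<subseteq>W. card K = k + 2 \<longrightarrow> \<not> pairwise (\<lambda>x y. (x, y) \<in> R) K"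
    proof (intro allI impI)
      fix K assume K: "K \<subseteq> W" "card K = k + 2"
      have "finite K" using K fin finite_subset by blast
      moreover have "v \<notin> K" using K vU by (auto simp: U_def)
      ultimately have "card (insert v K) = Suc k + 2" using K by simp
      moreover have "insert v K \<subseteq> V" using K WV v by auto
      ultimately have "\<not> pairwise (\<lambda>x y. (x, y) \<in> R) (insert v K)"
        using Suc.prems(2) by simp
      moreover have "(v, x) \<in> R" "(x, v) \<in> R" if "x \<in> K" for x
        using that K(1) assms(2) by (auto simp: W_def dest: symD)
      ultimately show "\<not> pairwise (\<lambda>x y. (x, y) \<in> R) K" by (auto simp: pairwise_insert)
    qed
    note IH = Suc.IH[OF fin(1) noK]
    have dsplit: "d x = card (R `` {x} \<inter> W) + card (R `` {x} \<inter> U)" for x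
    proof -
      have "R `` {x} \<inter> V = (R `` {x} \<inter> W) \<union> (R `` {x} \<inter> U)" using WV by (auto simp: U_def)
      moreover have "(R `` {x} \<inter> W) \<inter> (R `` {x} \<inter> U) = {}" by (auto simp: U_def)
      ultimately show ?thesis unfolding d_def using fin by (simp add: card_Un_disjoint)
    qed
    \<comment> \<open>\<open>S\<close> counts the arcs from \<open>U\<close> to \<open>W\<close> and
      \<open>T\<close> all arcs leaving \<open>U\<close> within \<open>V\<close>, so T - S counts
      the arcs inside \<open>U\<close>. By symmetry \<open>S\<close> also counts the arcs from
      \<open>W\<close> to \<open>U\<close>, which gives \<open>D\<close> below.\<close>
    define S where "S = (\<Sum>u\<in>U. card (R `` {u} \<inter> W))"
    define T where "T = (\<Sum>u\<in>U. d u)"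
    define D where "D = (\<Sum>u\<in>V. d u)"
    have "D = T + (\<Sum>w\<in>W. d w)"
      unfolding D_def T_def U_def using sum.subset_diff[OF WV Suc.prems(1)] by (simp add: add.commute)
    also have "(\<Sum>w\<in>W. d w) = DW + S"
      unfolding dsplit sum.distrib DW_def S_def using sum_card_swap[OF fin assms(2)] by simp
    finally have D: "D = T + DW + S" by simp
    have ST: "S \<le> T" unfolding S_def T_def by (intro sum_mono) (simp add: dsplit)
    have TU: "T \<le> card U * \<Delta>" unfolding T_def
      using sum_bounded_above[of U d \<Delta>] d_le by (auto simp: U_def)
    have IH1: "(k + 1) * DW \<le> k * \<Delta>\<^sup>2" using IH by (simp add: DW_def cW)
    \<comment> \<open>The computation moves to the integers because the identity \<open>key\<close>
      needs genuine subtraction.\<close>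
    define a b where "a = int (card V)" and "b = int \<Delta>"
    have cUi: "int (card U) = a - b" using cU by (simp add: a_def b_def)
    have TUi: "int T \<le> (a - b) * b"
      using TU cUi by (metis b_def of_nat_mono of_nat_mult)
    have IHi: "(int k + 1) * int DW \<le> int k * b\<^sup>2"
    proof -
      have "int ((k + 1) * DW) \<le> int (k * \<Delta>\<^sup>2)" using IH1 by (rule of_nat_mono)
      then show ?thesis by (simp add: b_def algebra_simps)
    qed
    \<comment> \<open>With b the maximum degree, a complete square accounts for the choice of b;
      every subtracted term is nonnegative, so all vanish in the case of equality.\<close>
    have key: "((int k + 2) * int D) * (int k + 1) =
        (int k + 1) * a\<^sup>2 * (int k + 1) - ((int k + 1) * a - (int k + 2) * b)\<^sup>2
        - (int k + 2) * (int k * b\<^sup>2 - (int k + 1) * int DW)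
        - (int k + 2) * (int k + 1) * (2 * ((a - b) * b - int T) + (int T - int S))"
      unfolding D by (simp add: power2_eq_square algebra_simps)
    have nn: "0 \<le> ((int k + 1) * a - (int k + 2) * b)\<^sup>2"
      "0 \<le> (int k + 2) * (int k * b\<^sup>2 - (int k + 1) * int DW)"
      "0 \<le> (int k + 2) * (int k + 1) * (2 * ((a - b) * b - int T) + (int T - int S))"
      using IHi TUi ST by (auto intro!: mult_nonneg_nonneg)
    have "((int k + 2) * int D) * (int k + 1) \<le> (int k + 1) * a\<^sup>2 * (int k + 1)"
      using key nn by linarith
    then have le: "(int k + 2) * int D \<le> (int k + 1) * a\<^sup>2" by (simp add: mult.commute)
    have "int ((Suc k + 1) * D) \<le> int (Suc k * (card V)\<^sup>2)"
      using le by (simp add: a_def algebra_simps)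
    then have bound: "(Suc k + 1) * D \<le> Suc k * (card V)\<^sup>2" by (simp only: of_nat_le_iff)
    moreover have "\<exists>P. partition_on V P \<and> card P = Suc k + 1 \<and> (\<forall>A\<in>P. (Suc k + 1) * card A = card V) \<and>
        (\<forall>u\<in>V. \<forall>v\<in>V. (u, v) \<in> R \<longleftrightarrow> \<not> (\<exists>A\<in>P. u \<in> A \<and> v \<in> A))"
      if eq: "(Suc k + 1) * D = Suc k * (card V)\<^sup>2"
    proof -
      have "int ((Suc k + 1) * D) = int (Suc k * (card V)\<^sup>2)" using eq by simp
      then have "(int k + 2) * int D * (int k + 1) = (int k + 1) * a\<^sup>2 * (int k + 1)"
        by (simp add: a_def algebra_simps)
      then have z: "((int k + 1) * a - (int k + 2) * b)\<^sup>2 = 0"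
        "(int k + 2) * (int k * b\<^sup>2 - (int k + 1) * int DW) = 0"
        "(int k + 2) * (int k + 1) * (2 * ((a - b) * b - int T) + (int T - int S)) = 0"
        using key nn by linarith+
      have ab: "(int k + 1) * a = (int k + 2) * b" using z(1) by simp
      have "int k * b\<^sup>2 - (int k + 1) * int DW = 0" using z(2) by (simp del: right_diff_distrib')
      then have "int (k * \<Delta>\<^sup>2) = int ((k + 1) * DW)" by (simp add: b_def algebra_simps)
      then have IHeq: "(k + 1) * DW = k * \<Delta>\<^sup>2" by (simp only: of_nat_eq_iff)
      have "2 * ((a - b) * b - int T) + (int T - int S) = 0" using z(3) by (simp add: mult_eq_0_iff)
      moreover have "int S \<le> int T" using ST by simp
      moreover have "t = c \<and> t = s" if "2 * (c - t) + (t - s) = 0" "s \<le> t" "t \<le> c" for c t s :: int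
        using that by presburger
      \<comment> \<open>\<open>T1\<close> forces every vertex of \<open>U\<close> to have the
        maximum degree, and \<open>T2\<close> forces \<open>U\<close> to be independent.\<close>
      ultimately have T1: "int T = (a - b) * b" and "int T = int S" using TUi by blast+
      then have T2: "T = S" by simp
      have abn: "(k + 1) * card V = (k + 2) * \<Delta>"
      proof -
        have "int ((k + 1) * card V) = int ((k + 2) * \<Delta>)" using ab by (simp add: a_def b_def algebra_simps)
        then show ?thesis by (simp only: of_nat_eq_iff)
      qed
      have "card V > 0" using False Suc.prems(1) by (simp add: card_gt_0_iff)
      \<comment> \<open>The structural half of the induction hypothesis concerns nonempty sets, so
        \<open>W\<close> must be shown nonempty.\<close>
      have "\<Delta> \<noteq> 0"
      proof
        assume "\<Delta> = 0"
        with abn have "(k + 1) * card V = 0" by simp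
        with \<open>card V > 0\<close> show False by simp
      qed
      then have "W \<noteq> {}" using cW by auto
      then obtain P where P: "partition_on W P" "card P = k + 1" "\<forall>A\<in>P. (k + 1) * card A = \<Delta>"
        "\<forall>u\<in>W. \<forall>v\<in>W. (u, v) \<in> R \<longleftrightarrow> \<not> (\<exists>A\<in>P. u \<in> A \<and> v \<in> A)"
        using IH IHeq unfolding DW_def cW by auto
      have "(\<Sum>u\<in>U. \<Delta> - d u) = 0"
      proof -
        have "(\<Sum>u\<in>U. \<Delta> - d u) = (\<Sum>u\<in>U. \<Delta>) - T"
          unfolding T_def using d_le by (intro sum_subtractf_nat) (auto simp: U_def)
        moreover have "int (card U * \<Delta>) = int T" using T1 cUi by (simp add: b_def)
        ultimately show ?thesis by simp
      qed
      then have dU: "d u = \<Delta>" if "u \<in> U" for u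
        using that fin d_le[of u] by (simp add: U_def le_antisym)
      have "(\<Sum>u\<in>U. card (R `` {u} \<inter> U)) = 0"
        using T2 unfolding T_def S_def dsplit sum.distrib by simp
      then have UU: "(u, u') \<notin> R" if "u \<in> U" "u' \<in> U" for u u'
        using that fin by auto
      \<comment> \<open>A vertex of \<open>U\<close> has \<Delta> = |W| neighbours in
        \<open>V\<close> and none of them in \<open>U\<close>, so they fill
        \<open>W\<close>.\<close>
      have UW: "(u, w) \<in> R" if "u \<in> U" "w \<in> W" for u w
      proof -
        have "card (R `` {u} \<inter> U) = 0" using UU that by (auto simp: card_eq_0_iff)
        then have "card (R `` {u} \<inter> W) = card W" using dU[OF that(1)] dsplit[of u] cW by simp
        then have "R `` {u} \<inter> W = W" using fin by (intro card_subset_eq) auto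
        then show ?thesis using that by auto
      qed
      have Wun: "\<Union>P = W" using P(1) by (simp add: partition_on_def)
      have UP: "U \<notin> P" using Wun vU by (auto simp: U_def)
      have fP: "finite P" using P(2) by (intro card_ge_0_finite) auto
      have "partition_on V (insert U P)"
        using P(1) vU WV by (auto simp: partition_on_def disjoint_def U_def)
      moreover have "card (insert U P) = Suc k + 1" using P(2) UP fP by simp
      \<comment> \<open>Both cases rest on \<open>abn\<close>. For the new part, |U| = |V| -
        \<Delta> turns it into (k + 2)|U| = |V|; for an old part, (k + 1)|A| = \<Delta> is
        multiplied by k + 2 and then k + 1 is cancelled.\<close>
      moreover have "(Suc k + 1) * card A = card V" if "A \<in> insert U P" for A
      proof (cases "A = U")
        case True
        have "(k + 2) * card U + (k + 2) * \<Delta> = (k + 2) * card V"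
          by (metis cU distrib_left)
        also have "\<dots> = (k + 1) * card V + card V" by simp
        finally have "(k + 2) * card U = card V" using abn by linarith
        then show ?thesis using True by simp
      next
        case False
        with that P(3) have "(k + 1) * card A = \<Delta>" by auto
        with abn have "(k + 1) * ((k + 2) * card A) = (k + 1) * card V"
          by (metis mult.left_commute)
        then show ?thesis by (simp del: mult_Suc mult_Suc_right)
      qed
      moreover have "(x, y) \<in> R \<longleftrightarrow> \<not> (\<exists>A\<in>insert U P. x \<in> A \<and> y \<in> A)" if "x \<in> V" "y \<in> V" for x y
      proof -
        have "x \<in> W \<longleftrightarrow> x \<notin> U" "y \<in> W \<longleftrightarrow> y \<notin> U" using that by (auto simp: U_def)
        then show ?thesis
          using UU[of x y] UW[of x y] UW[of y x] P(4) Wun assms(2)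
          by (cases "x \<in> U"; cases "y \<in> U") (auto dest: symD)
      qed
      ultimately show ?thesis by blast
    qed
    ultimately show ?thesis unfolding D_def d_def by blast
  qed simp
qed

section \<open>From graphs to relations\<close>

text \<open>The complete digraph on a pairwise adjacent \<open>K\<close> would be a forbidden
  subgraph. This puts clique-freeness into the form that \<open>turan\<close> assumes.\<close>

lemma clique_freeD:
  assumes "clique_free k G" "pair_graph G" "K \<subseteq> pverts G" "card K = k"
  shows "\<not> pairwise (\<lambda>x y. (x, y) \<in> parcs G) K"
proof
  assume *: "pairwise (\<lambda>x y. (x, y) \<in> parcs G) K"
  interpret pair_graph G by fact
  define H where "H = \<lparr>pverts = K, parcs = {(u, v). (u, v) \<in> K \<times> K \<and> u \<noteq> v}\<rparr>"
  have "finite K" using assms(3) pair_finite_verts by (rule finite_subset)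
  then have "K\<^bsub>k\<^esub> (with_proj H)" using assms(4) by (simp add: complete_digraph_pair_def H_def)
  moreover have "subgraph (with_proj H) (with_proj G)"
    unfolding subgraph_def
  proof (intro conjI)
    show "wf_digraph (with_proj H)"
      unfolding wf_digraph_wp_iff by unfold_locales (auto simp: H_def)
    show "verts (with_proj H) \<subseteq> verts (with_proj G)" using assms(3) by (simp add: H_def)
    show "arcs (with_proj H) \<subseteq> arcs (with_proj G)" using * by (auto simp: H_def pairwise_def)
    show "wf_digraph (with_proj G)" by (rule wf_digraph)
    show "compatible (with_proj G) (with_proj H)" by (simp add: compatible_def)
  qed
  ultimately show False using assms(1) by (auto simp: clique_free_def)
qed

lemma pair_graph_irrefl_parcs:
  assumes "pair_graph G"
  shows "irrefl (parcs G)"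
proof -
  interpret pair_graph G by fact
  have "(x, x) \<notin> parcs G" for x using pair_no_loops[of "(x, x)"] by auto
  then show ?thesis by (simp add: irrefl_def)
qed

lemma pair_graph_sym_parcs:
  assumes "pair_graph G"
  shows "sym (parcs G)"
proof -
  interpret pair_graph G by fact
  show ?thesis using pair_sym_arcs by (simp add: symmetric_def)
qed

lemma nbhd_eq_Image: "nbhd G v = parcs G `` {v}"
  by (auto simp: nbhd_def)

section \<open>Counting the edges between positive and negative vertices\<close>

lemma sum_signs:
  fixes f :: "'a \<Rightarrow> int"
  assumes "finite A" "\<And>x. x \<in> A \<Longrightarrow> f x \<in> {-1, 1}"
  shows "sum f A = int (card {x \<in> A. f x = 1}) - int (card {x \<in> A. f x \<noteq> 1})"
proof -
  have "sum f A = (\<Sum>x\<in>A. if f x = 1 then 1 else - 1)"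
    using assms(2) by (intro sum.cong) auto
  also have "\<dots> = int (card (A \<inter> {x. f x = 1})) - int (card (A \<inter> - {x. f x = 1}))"
    using assms(1) by (simp add: sum.If_cases)
  also have "A \<inter> {x. f x = 1} = {x \<in> A. f x = 1}" by blast
  also have "A \<inter> - {x. f x = 1} = {x \<in> A. f x \<noteq> 1}" by blast
  finally show ?thesis .
qed

context
  fixes G :: "'a pair_pre_digraph" and f :: "'a \<Rightarrow> int" and P M :: "'a set" and D :: nat
  assumes G: "pair_graph G" and f: "nnsdf G f"
  defines "P \<equiv> {v \<in> pverts G. f v = 1}" and "M \<equiv> {v \<in> pverts G. f v \<noteq> 1}"
    and "D \<equiv> (\<Sum>u\<in>P. card (parcs G `` {u} \<inter> P))"
begin

interpretation pair_graph G by (rule G)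

private lemma fin: "finite P" "finite M"
  using pair_finite_verts by (auto simp: P_def M_def)

lemma nnsdf_card_split: "card (pverts G) = card P + card M"
proof -
  have "pverts G = P \<union> M" by (auto simp: P_def M_def)
  moreover have "P \<inter> M = {}" by (auto simp: P_def M_def)
  ultimately show ?thesis using fin by (simp add: card_Un_disjoint)
qed

lemma nnsdf_weight: "sum f (pverts G) = 2 * int (card P) - int (card (pverts G))"
proof -
  have "sum f (pverts G) = int (card P) - int (card M)"
    unfolding P_def M_def using f pair_finite_verts
    by (intro sum_signs) (auto simp: nnsdf_def Pi_iff)
  then show ?thesis using nnsdf_card_split by simp
qed

private lemma nbhd_weight:
  assumes "v \<in> pverts G"
  shows "f v + int (card (parcs G `` {v} \<inter> P)) - int (card (parcs G `` {v} \<inter> M)) \<ge> 0"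
proof -
  have sub: "parcs G `` {v} \<subseteq> pverts G" using in_arcsD2 by auto
  then have finN: "finite (parcs G `` {v})" using pair_finite_verts finite_subset by blast
  \<comment> \<open>Without loops, the value of \<open>v\<close> splits off as a separate
    summand.\<close>
  have "v \<notin> parcs G `` {v}"
    using pair_graph_irrefl_parcs[OF G] by (auto simp: irrefl_def)
  then have "sum f (closed_nbhd G v) = f v + sum f (parcs G `` {v})"
    using finN by (simp add: closed_nbhd_def nbhd_eq_Image)
  also have "sum f (parcs G `` {v}) = int (card {x \<in> parcs G `` {v}. f x = 1})
      - int (card {x \<in> parcs G `` {v}. f x \<noteq> 1})"
    using sub f finN by (intro sum_signs) (auto simp: nnsdf_def Pi_iff)
  also have "{x \<in> parcs G `` {v}. f x = 1} = parcs G `` {v} \<inter> P" using sub by (auto simp: P_def)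
  also have "{x \<in> parcs G `` {v}. f x \<noteq> 1} = parcs G `` {v} \<inter> M" using sub by (auto simp: M_def)
  finally show ?thesis using f assms by (auto simp: nnsdf_def)
qed

text \<open>The vertex's own value 1 pays for one extra negative neighbour.\<close>

lemma nnsdf_pos:
  assumes "u \<in> P" shows "card (parcs G `` {u} \<inter> M) \<le> card (parcs G `` {u} \<inter> P) + 1"
  using nbhd_weight[of u] assms by (auto simp: P_def)

text \<open>The vertex's own value -1 has to be offset by a surplus of positive neighbours. Hence at
  least one neighbour is positive, and if exactly one is, none is negative.\<close>

lemma nnsdf_neg:
  assumes "v \<in> M" shows "card (parcs G `` {v} \<inter> M) + 1 \<le> card (parcs G `` {v} \<inter> P)"
proof -
  have "f v = -1" using assms f by (auto simp: M_def nnsdf_def Pi_iff)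
  with nbhd_weight[of v] assms show ?thesis by (auto simp: M_def)
qed

private lemma neg_ge: "card M \<le> (\<Sum>v\<in>M. card (parcs G `` {v} \<inter> P))"
  using sum_mono[of M "\<lambda>_. 1" "\<lambda>v. card (parcs G `` {v} \<inter> P)"] nnsdf_neg by fastforce

private lemma cross: "(\<Sum>v\<in>M. card (parcs G `` {v} \<inter> P)) = (\<Sum>u\<in>P. card (parcs G `` {u} \<inter> M))"
  using sum_card_swap fin pair_graph_sym_parcs[OF G] by blast

private lemma pos_le: "(\<Sum>u\<in>P. card (parcs G `` {u} \<inter> M)) \<le> D + card P"
proof -
  have "(\<Sum>u\<in>P. card (parcs G `` {u} \<inter> M)) \<le> (\<Sum>u\<in>P. card (parcs G `` {u} \<inter> P) + 1)"
    using nnsdf_pos by (intro sum_mono)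
  then show ?thesis by (simp only: sum.distrib D_def sum_constant mult_1_right of_nat_id)
qed

text \<open>The number of edges between \<open>P\<close> and \<open>M\<close> is at least |M| when
  counted from \<open>M\<close>, and at most D + |P| when counted from \<open>P\<close>.\<close>

lemma nnsdf_order_le: "card (pverts G) \<le> D + 2 * card P"
  using neg_ge cross pos_le nnsdf_card_split by linarith

text \<open>Equality makes both estimates of the edge count tight, and a termwise inequality between
  finite sums of equal value is an equality in each term.\<close>

lemma nnsdf_order_eq:
  assumes "card (pverts G) = D + 2 * card P"
  shows "v \<in> M \<Longrightarrow> card (parcs G `` {v} \<inter> P) = 1"
    and "u \<in> P \<Longrightarrow> card (parcs G `` {u} \<inter> M) = card (parcs G `` {u} \<inter> P) + 1"
proof -
  have eq: "card M = (\<Sum>v\<in>M. card (parcs G `` {v} \<inter> P))"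
    "(\<Sum>u\<in>P. card (parcs G `` {u} \<inter> M)) = D + card P"
    using neg_ge cross pos_le nnsdf_card_split assms by linarith+
  show "card (parcs G `` {v} \<inter> P) = 1" if "v \<in> M"
    by (rule sum_mono_inv[of "\<lambda>_. 1" M, symmetric]) (use eq(1) nnsdf_neg that fin in fastforce)+
  show "card (parcs G `` {u} \<inter> M) = card (parcs G `` {u} \<inter> P) + 1" if "u \<in> P"
    by (rule sum_mono_inv[OF _ nnsdf_pos that fin(1)])
      (use eq(2) in \<open>simp_all only: sum.distrib D_def sum_constant mult_1_right of_nat_id\<close>)
qed

end

section \<open>The quadratic inequality over the reals\<close>

text \<open>Here \<open>a\<close> stands for the number of positive vertices, so 2a - n is the
  weight. Multiplying the quadratic inequality by r - 1 and adding r^2 completes the square: it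
  becomes X \<le> Y^2 for the \<open>X\<close> and \<open>Y\<close> of the proof, and Y \<ge> 0
  allows taking roots.\<close>

lemma sqrt_bound:
  fixes r n a :: real
  assumes "1 < r" "0 \<le> a" "0 \<le> n" "r * n \<le> (r - 1) * a\<^sup>2 + 2 * r * a"
  defines "B \<equiv> - (2 * r / (r - 1)) + 2 / (r - 1) * sqrt (r\<^sup>2 + r * (r - 1) * n) - n"
  shows "B \<le> 2 * a - n" "B = 2 * a - n \<longleftrightarrow> r * n = (r - 1) * a\<^sup>2 + 2 * r * a"
proof -
  define X where "X = r\<^sup>2 + r * (r - 1) * n"
  define Y where "Y = r + (r - 1) * a"
  have Y: "0 \<le> Y" using assms by (simp add: Y_def)
  have X: "0 \<le> X" using assms by (simp add: X_def)
  have XY: "Y\<^sup>2 - X = (r - 1) * ((r - 1) * a\<^sup>2 + 2 * r * a - r * n)"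
    by (simp add: X_def Y_def power2_eq_square algebra_simps)
  \<comment> \<open>The gap between weight and bound is a positive multiple of Y - sqrt X, so both
    claims reduce to comparing Y with sqrt X.\<close>
  have B: "2 * a - n - B = 2 / (r - 1) * (Y - sqrt X)"
  proof -
    have "2 / (r - 1) * Y = 2 * r / (r - 1) + 2 * a"
      using assms(1) by (simp add: Y_def field_simps)
    then show ?thesis unfolding B_def X_def[symmetric] right_diff_distrib[of _ Y] by simp
  qed
  have "X \<le> Y\<^sup>2" using XY assms by (smt (verit) mult_nonneg_nonneg)
  then have "sqrt X \<le> Y" using Y by (rule real_le_lsqrt[rotated])
  then have "0 \<le> 2 / (r - 1) * (Y - sqrt X)" using assms by simp
  then show "B \<le> 2 * a - n" using B by linarith
  have "B = 2 * a - n \<longleftrightarrow> 2 / (r - 1) * (Y - sqrt X) = 0" using B by linarith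
  also have "\<dots> \<longleftrightarrow> sqrt X = Y" using assms by auto
  also have "\<dots> \<longleftrightarrow> X = Y\<^sup>2" using X Y by (metis real_sqrt_pow2 real_sqrt_abs abs_of_nonneg)
  also have "\<dots> \<longleftrightarrow> Y\<^sup>2 - X = 0" by auto
  also have "\<dots> \<longleftrightarrow> r * n = (r - 1) * a\<^sup>2 + 2 * r * a" unfolding XY using assms by auto
  finally show "B = 2 * a - n \<longleftrightarrow> r * n = (r - 1) * a\<^sup>2 + 2 * r * a" .
qed

section \<open>The signed domination number as an attained minimum\<close>

lemma nnsd_number_set:
  assumes "pair_graph G"
  shows "finite {sum f (pverts G) | f. nnsdf G f}" "{sum f (pverts G) | f. nnsdf G f} \<noteq> {}"
proof -
  interpret pair_graph G by fact
  let ?n = "int (card (pverts G))"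
  have "\<bar>sum f (pverts G)\<bar> \<le> ?n" if "nnsdf G f" for f
  proof -
    have "\<bar>sum f (pverts G)\<bar> \<le> (\<Sum>v\<in>pverts G. \<bar>f v\<bar>)" by (rule sum_abs)
    also have "\<dots> = (\<Sum>v\<in>pverts G. 1)" using that by (intro sum.cong) (auto simp: nnsdf_def Pi_iff)
    finally show ?thesis by simp
  qed
  then have "{sum f (pverts G) | f. nnsdf G f} \<subseteq> {- ?n..?n}" by fastforce
  then show "finite {sum f (pverts G) | f. nnsdf G f}" using finite_subset by blast
  have "nnsdf G (\<lambda>_. 1)" by (auto simp: nnsdf_def)
  then show "{sum f (pverts G) | f. nnsdf G f} \<noteq> {}" by blast
qed

lemma nnsd_number_attained:
  assumes "pair_graph G"
  obtains f where "nnsdf G f" "nnsd_number G = sum f (pverts G)"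
  using Min_in[OF nnsd_number_set[OF assms]] unfolding nnsd_number_def by auto

lemma nnsd_number_le:
  assumes "pair_graph G" "nnsdf G f"
  shows "nnsd_number G \<le> sum f (pverts G)"
  unfolding nnsd_number_def using assms(2) by (intro Min_le nnsd_number_set[OF assms(1)]) auto

section \<open>Isomorphisms of pair graphs\<close>

text \<open>A digraph isomorphism carries separate maps for vertices, arcs, tails and heads. When
  arcs are pairs, the tail and head maps must be the projections, so the vertex map determines the
  action on arcs.\<close>

lemma digraph_iso_with_proj_iff:
  assumes "pair_wf_digraph G"
  shows "digraph_iso (with_proj G) (with_proj H) \<longleftrightarrow>
    (\<exists>\<phi>. inj_on \<phi> (pverts G) \<and> pverts H = \<phi> ` pverts G \<and> parcs H = map_prod \<phi> \<phi> ` parcs G)"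
proof
  assume "digraph_iso (with_proj G) (with_proj H)"
  then obtain h where h: "pre_digraph.digraph_isomorphism (with_proj G) h"
    "with_proj H = app_iso h (with_proj G)"
    by (auto simp: digraph_iso_def)
  have "verts (with_proj H) = iso_verts h ` pverts G" "arcs (with_proj H) = iso_arcs h ` parcs G"
    "tail (with_proj H) = iso_tail h" "head (with_proj H) = iso_head h"
    unfolding h(2) by simp_all
  then have H: "pverts H = iso_verts h ` pverts G" "parcs H = iso_arcs h ` parcs G"
    "iso_tail h = fst" "iso_head h = snd" by simp_all
  have "iso_arcs h e = map_prod (iso_verts h) (iso_verts h) e" if "e \<in> parcs G" for e
    using h(1) that H(3,4) by (auto simp: pre_digraph.digraph_isomorphism_def prod_eq_iff)
  then have "iso_arcs h ` parcs G = map_prod (iso_verts h) (iso_verts h) ` parcs G"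
    by (intro image_cong) auto
  with H h(1) show "\<exists>\<phi>. inj_on \<phi> (pverts G) \<and> pverts H = \<phi> ` pverts G \<and> parcs H = map_prod \<phi> \<phi> ` parcs G"
    by (intro exI[of _ "iso_verts h"]) (simp add: pre_digraph.digraph_isomorphism_def)
next
  assume "\<exists>\<phi>. inj_on \<phi> (pverts G) \<and> pverts H = \<phi> ` pverts G \<and> parcs H = map_prod \<phi> \<phi> ` parcs G"
  then obtain \<phi> where \<phi>: "inj_on \<phi> (pverts G)" "pverts H = \<phi> ` pverts G"
    "parcs H = map_prod \<phi> \<phi> ` parcs G" by blast
  interpret pair_wf_digraph G by fact
  have "inj_on (map_prod \<phi> \<phi>) (parcs G)"
    by (rule inj_on_subset[OF map_prod_inj_on[OF \<phi>(1) \<phi>(1)]]) (auto dest: wellformed')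
  then have "pre_digraph.digraph_isomorphism (with_proj G)
      \<lparr>iso_verts = \<phi>, iso_arcs = map_prod \<phi> \<phi>, iso_head = snd, iso_tail = fst\<rparr>"
    using \<phi>(1) wf_digraph by (simp add: pre_digraph.digraph_isomorphism_def)
  moreover have "with_proj H = app_iso
      \<lparr>iso_verts = \<phi>, iso_arcs = map_prod \<phi> \<phi>, iso_head = snd, iso_tail = fst\<rparr> (with_proj G)"
    using \<phi> by (simp add: app_iso_def with_proj_def)
  ultimately show "digraph_iso (with_proj G) (with_proj H)" by (auto simp: digraph_iso_def)
qed

text \<open>An isomorphism maps closed neighbourhoods onto closed neighbourhoods, so the sums agree
  after reindexing. It serves to transport a function from the corona to \<open>G\<close>.\<close>

lemma nnsdf_pullback:
  assumes "pair_wf_digraph G" "inj_on \<phi> (pverts G)" "pverts C = \<phi> ` pverts G"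
    "parcs C = map_prod \<phi> \<phi> ` parcs G" "nnsdf C g"
  shows "nnsdf G (g \<circ> \<phi>)"
proof -
  interpret pair_wf_digraph G by fact
  have "sum (g \<circ> \<phi>) (closed_nbhd G v) \<ge> 0" if v: "v \<in> pverts G" for v
  proof -
    have sub: "closed_nbhd G v \<subseteq> pverts G"
      using v by (auto simp: closed_nbhd_def nbhd_def dest: wellformed')
    have "nbhd C (\<phi> v) = \<phi> ` nbhd G v"
    proof (intro set_eqI iffI)
      fix w assume "w \<in> nbhd C (\<phi> v)"
      then obtain x y where xy: "(x, y) \<in> parcs G" "\<phi> v = \<phi> x" "w = \<phi> y"
        by (auto simp: nbhd_def assms(4))
      \<comment> \<open>An arc of \<open>C\<close> at \<phi> v comes from an arc of \<open>G\<close>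
        whose tail is only known to have the same image; injectivity identifies that tail with
        \<open>v\<close>.\<close>
      then have "v = x" using v assms(2) by (auto simp: inj_on_def dest: wellformed')
      with xy show "w \<in> \<phi> ` nbhd G v" by (auto simp: nbhd_def)
    qed (auto simp: nbhd_def assms(4))
    then have "closed_nbhd C (\<phi> v) = \<phi> ` closed_nbhd G v" by (simp add: closed_nbhd_def)
    then have "sum g (closed_nbhd C (\<phi> v)) = sum (g \<circ> \<phi>) (closed_nbhd G v)"
      using sum.reindex[OF inj_on_subset[OF assms(2) sub]] by simp
    then show ?thesis using assms(3,5) v by (auto simp: nnsdf_def)
  qed
  then show ?thesis using assms(3,5) by (auto simp: nnsdf_def)
qed

section \<open>Balanced complete multipartite graphs and their coronas\<close>

lemma balanced_complete_partite_card:
  assumes "balanced_complete_partite r p H"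
  shows "card (pverts H) = r * p"
proof -
  obtain P where P: "pair_graph H" "partition_on (pverts H) P" "card P = r" "\<forall>A\<in>P. card A = p"
    using assms by (auto simp: balanced_complete_partite_def complete_multipartite_def)
  interpret pair_graph H by fact
  have fin: "finite A" if "A \<in> P" for A
    using pair_finite_verts by (rule rev_finite_subset) (use that P(2) in \<open>auto simp: partition_on_def\<close>)
  have "pairwise disjnt P"
    using P(2) by (auto simp: partition_on_def disjoint_def pairwise_def disjnt_def)
  then have "card (\<Union>P) = sum card P" using fin by (rule card_Union_disjoint)
  moreover have "\<Union>P = pverts H" using P(2) by (simp add: partition_on_def)
  ultimately show ?thesis using P by simp
qed

text \<open>The neighbours of \<open>u\<close> are the vertices outside its own part, r p - p in
  number. One more than this degree is the number of leaves per vertex in the extremal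
  corona.\<close>

lemma balanced_complete_partite_degree:
  assumes "balanced_complete_partite r p H" "u \<in> pverts H"
  shows "card (nbhd H u) = (r - 1) * p"
proof -
  obtain P where P: "pair_graph H" "partition_on (pverts H) P" "\<forall>A\<in>P. card A = p"
    "parcs H = {(u, v). u \<in> pverts H \<and> v \<in> pverts H \<and> \<not> (\<exists>A \<in> P. u \<in> A \<and> v \<in> A)}"
    using assms(1) by (auto simp: balanced_complete_partite_def complete_multipartite_def)
  interpret pair_graph H by fact
  obtain A where A: "A \<in> P" "u \<in> A" using P(2) assms(2) by (auto simp: partition_on_def)
  have un: "\<And>B. B \<in> P \<Longrightarrow> u \<in> B \<Longrightarrow> B = A"
    using A P(2) unfolding partition_on_def disjoint_def by blast
  have sub: "A \<subseteq> pverts H" using A P(2) by (auto simp: partition_on_def)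
  have "(\<exists>B\<in>P. u \<in> B \<and> w \<in> B) \<longleftrightarrow> w \<in> A" for w
    using un A by blast
  then have "nbhd H u = pverts H - A" using assms(2) by (auto simp: nbhd_def P(4))
  then have "card (nbhd H u) = card (pverts H) - p"
    using card_Diff_subset[OF finite_subset[OF sub pair_finite_verts] sub] A P(3) by simp
  then show ?thesis using balanced_complete_partite_card[OF assms(1)] by (simp add: diff_mult_distrib)
qed

text \<open>With value 1 on \<open>H\<close> and -1 on the leaves every closed neighbourhood sums to
  exactly 0: at a vertex of \<open>H\<close>, the deg + 1 positive values cancel the
  \<open>m\<close> leaves, and a leaf cancels against its only neighbour.\<close>

lemma corona_nnsdf:
  assumes "pair_graph H" "\<And>u. u \<in> pverts H \<Longrightarrow> card (nbhd H u) + 1 = m"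
  shows "nnsdf (corona H (edgeless_graph m)) (case_sum (\<lambda>_. 1) (\<lambda>_. -1))"
proof -
  interpret pair_graph H by fact
  let ?C = "corona H (edgeless_graph m)" and ?f = "case_sum (\<lambda>_. 1) (\<lambda>_. -1) :: 'a + 'a \<times> nat \<Rightarrow> int"
  have "sum ?f (closed_nbhd ?C (Inl i)) = 0" if i: "i \<in> pverts H" for i
  proof -
    have eq: "closed_nbhd ?C (Inl i) = Inl ` (insert i (nbhd H i)) \<union> Inr ` ({i} \<times> {..<m})"
      using i by (auto simp: closed_nbhd_def nbhd_def corona_def edgeless_graph_def)
    have "nbhd H i \<subseteq> pverts H" by (auto simp: nbhd_def dest: wellformed')
    then have fin: "finite (nbhd H i)" using pair_finite_verts finite_subset by blast
    have ni: "i \<notin> nbhd H i"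
      using pair_graph_irrefl_parcs[OF assms(1)] by (auto simp: nbhd_def irrefl_def)
    have "sum ?f (closed_nbhd ?C (Inl i)) =
        sum ?f (Inl ` (insert i (nbhd H i))) + sum ?f (Inr ` ({i} \<times> {..<m}))"
      unfolding eq using fin by (intro sum.union_disjoint) auto
    also have "sum ?f (Inl ` (insert i (nbhd H i))) = int m"
      using fin ni assms(2)[OF i] by (subst sum.reindex) auto
    also have "sum ?f (Inr ` ({i} \<times> {..<m})) = - int m"
      by (subst sum.reindex) auto
    finally show ?thesis by simp
  qed
  moreover have "sum ?f (closed_nbhd ?C (Inr (i, x))) = 0" if "i \<in> pverts H" "x < m" for i x
  proof -
    have "closed_nbhd ?C (Inr (i, x)) = {Inl i, Inr (i, x)}"
      using that by (auto simp: closed_nbhd_def nbhd_def corona_def edgeless_graph_def)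
    then show ?thesis by simp
  qed
  ultimately show ?thesis
    by (auto simp: nnsdf_def corona_def edgeless_graph_def)
qed

lemma sum_corona:
  assumes "finite (pverts H)"
  shows "sum (case_sum (\<lambda>_. 1) (\<lambda>_. -1)) (pverts (corona H (edgeless_graph m))) =
      int (card (pverts H)) - int (card (pverts H) * m)"
  using assms by (simp add: corona_def edgeless_graph_def sum.Plus card_cartesian_product)

lemma card_corona:
  assumes "finite (pverts H)"
  shows "card (pverts (corona H (edgeless_graph m))) = card (pverts H) + card (pverts H) * m"
  using assms by (simp add: corona_def edgeless_graph_def card_Plus card_cartesian_product)

text \<open>If every vertex outside \<open>P\<close> is a leaf attached to \<open>P\<close>, and
  each vertex of \<open>P\<close> carries \<open>m\<close> of them, then numbering the leaves at
  each vertex identifies \<open>G\<close> with the corona of the subgraph induced on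
  \<open>P\<close>.\<close>

lemma corona_iso:
  assumes G: "pair_graph G" and P: "P \<subseteq> pverts G"
    and leaf: "\<And>v. v \<in> pverts G - P \<Longrightarrow> \<exists>u\<in>P. parcs G `` {v} = {u}"
    and deg: "\<And>u. u \<in> P \<Longrightarrow> card (parcs G `` {u} - P) = m"
  shows "digraph_iso (with_proj G)
    (with_proj (corona \<lparr>pverts = P, parcs = parcs G \<inter> P \<times> P\<rparr> (edgeless_graph m)))"
proof -
  interpret pair_graph G by fact
  have sym: "(v, u) \<in> parcs G \<longleftrightarrow> (u, v) \<in> parcs G" for u v
    using pair_graph_sym_parcs[OF G] by (auto dest: symD)
  define L where "L u = parcs G `` {u} - P" for u
  have "finite (L u)" for u
    using pair_finite_verts by (rule rev_finite_subset) (auto simp: L_def dest: wellformed')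
  then have "\<exists>\<beta>. bij_betw \<beta> (L u) {..<m}" if "u \<in> P" for u
    using ex_bij_betw_finite_nat[of "L u"] deg[OF that] by (auto simp: L_def atLeast0LessThan)
  \<comment> \<open>\<beta> u numbers the leaves at \<open>u\<close>; \<pi> v is the vertex of
    \<open>P\<close> to which the leaf \<open>v\<close> is attached.\<close>
  then obtain \<beta> where \<beta>: "\<And>u. u \<in> P \<Longrightarrow> bij_betw (\<beta> u) (L u) {..<m}" by metis
  obtain \<pi> where \<pi>: "\<And>v. v \<in> pverts G - P \<Longrightarrow> \<pi> v \<in> P \<and> parcs G `` {v} = {\<pi> v}"
    using leaf by metis
  have Ldef: "v \<in> L u \<longleftrightarrow> v \<in> pverts G - P \<and> \<pi> v = u" if "u \<in> P" for u v
  proof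
    assume "v \<in> L u"
    then have v: "v \<in> pverts G - P" "(v, u) \<in> parcs G" using sym by (auto simp: L_def dest: wellformed')
    then have "u \<in> parcs G `` {v}" by auto
    with \<pi>[OF v(1)] v show "v \<in> pverts G - P \<and> \<pi> v = u" by auto
  next
    assume v: "v \<in> pverts G - P \<and> \<pi> v = u"
    with \<pi>[of v] have "u \<in> parcs G `` {v}" by auto
    with v sym show "v \<in> L u" by (auto simp: L_def)
  qed
  define \<phi> where "\<phi> v = (if v \<in> P then Inl v else Inr (\<pi> v, \<beta> (\<pi> v) v))" for v
  let ?C = "corona \<lparr>pverts = P, parcs = parcs G \<inter> P \<times> P\<rparr> (edgeless_graph m)"
  have inj: "inj_on \<phi> (pverts G)"
  proof (rule inj_onI)
    fix x y assume xy: "x \<in> pverts G" "y \<in> pverts G" "\<phi> x = \<phi> y"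
    show "x = y"
    proof (cases "x \<in> P")
      case True
      then show ?thesis using xy by (auto simp: \<phi>_def split: if_splits)
    next
      case False
      with xy have y: "y \<notin> P" "\<pi> x = \<pi> y" "\<beta> (\<pi> x) x = \<beta> (\<pi> x) y"
        by (auto simp: \<phi>_def split: if_splits)
      have "\<pi> x \<in> P" using \<pi> xy False by blast
      moreover have "x \<in> L (\<pi> x)" "y \<in> L (\<pi> x)" using Ldef calculation xy y False by auto
      ultimately show ?thesis using y(3) \<beta> by (meson bij_betw_def inj_onD)
    qed
  qed
  \<comment> \<open>Surjectivity onto the leaves: each index below \<open>m\<close> is taken by some
    leaf at \<open>u\<close>.\<close>
  have leafim: "\<exists>v\<in>pverts G - P. \<pi> v = u \<and> \<phi> v = Inr (u, x)" if "u \<in> P" "x < m" for u x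
  proof -
    have "x \<in> \<beta> u ` L u" using \<beta>[OF that(1)] that(2) by (auto simp: bij_betw_def)
    then obtain v where "v \<in> L u" "x = \<beta> u v" by auto
    then show ?thesis using Ldef[OF that(1)] by (auto simp: \<phi>_def)
  qed
  have leafin: "\<beta> (\<pi> v) v < m" if "v \<in> pverts G - P" for v
  proof -
    have "v \<in> L (\<pi> v)" using Ldef \<pi> that by blast
    then show ?thesis using \<beta> \<pi>[OF that] by (auto simp: bij_betw_def)
  qed
  have pv: "pverts ?C = \<phi> ` pverts G"
  proof (intro set_eqI iffI)
    fix z assume "z \<in> pverts ?C"
    then consider u where "z = Inl u" "u \<in> P" | u x where "z = Inr (u, x)" "u \<in> P" "x < m"
      by (auto simp: corona_def edgeless_graph_def)
    then show "z \<in> \<phi> ` pverts G"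
    proof cases
      case 1
      then show ?thesis using P by (intro image_eqI[of _ _ u]) (auto simp: \<phi>_def)
    next
      case 2
      with leafim[of u x] show ?thesis by (metis DiffD1 imageI)
    qed
  next
    fix z assume "z \<in> \<phi> ` pverts G"
    then obtain v where "v \<in> pverts G" "z = \<phi> v" by auto
    then show "z \<in> pverts ?C" using \<pi>[of v] leafin[of v]
      by (auto simp: \<phi>_def corona_def edgeless_graph_def)
  qed
  have \<pi>arc: "(v, \<pi> v) \<in> parcs G" "(\<pi> v, v) \<in> parcs G" if "v \<in> pverts G - P" for v
    using \<pi>[OF that] sym by auto
  have "e \<in> parcs ?C \<longleftrightarrow> e \<in> map_prod \<phi> \<phi> ` parcs G" for e
  proof (cases e)
    case (Pair z w)
    have "(z, w) \<in> parcs ?C \<longleftrightarrow> (z, w) \<in> map_prod \<phi> \<phi> ` parcs G"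
    proof
      assume "(z, w) \<in> parcs ?C"
      then consider (a) u v where "z = Inl u" "w = Inl v" "(u, v) \<in> parcs G" "u \<in> P" "v \<in> P"
        | (b) u x where "z = Inl u" "w = Inr (u, x)" "u \<in> P" "x < m"
        | (c) u x where "w = Inl u" "z = Inr (u, x)" "u \<in> P" "x < m"
        by (auto simp: corona_def edgeless_graph_def)
      then show "(z, w) \<in> map_prod \<phi> \<phi> ` parcs G"
      proof cases
        case a
        then show ?thesis by (intro image_eqI[of _ _ "(u, v)"]) (auto simp: \<phi>_def)
      next
        case b
        with leafim[of u x] obtain v where "v \<in> pverts G - P" "\<pi> v = u" "\<phi> v = w" by auto
        with b \<pi>arc[of v] show ?thesis by (intro image_eqI[of _ _ "(u, v)"]) (auto simp: \<phi>_def)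
      next
        case c
        with leafim[of u x] obtain v where "v \<in> pverts G - P" "\<pi> v = u" "\<phi> v = z" by auto
        with c \<pi>arc[of v] show ?thesis by (intro image_eqI[of _ _ "(v, u)"]) (auto simp: \<phi>_def)
      qed
    next
      assume "(z, w) \<in> map_prod \<phi> \<phi> ` parcs G"
      then obtain u v where uv: "(u, v) \<in> parcs G" "z = \<phi> u" "w = \<phi> v" by auto
      then have V: "u \<in> pverts G" "v \<in> pverts G" by (auto dest: wellformed')
      have im: "v \<in> parcs G `` {u}" "u \<in> parcs G `` {v}" using uv sym by auto
      \<comment> \<open>An endpoint outside \<open>P\<close> is a leaf, so the other endpoint is its
        support vertex in \<open>P\<close>. Hence no arc joins two leaves and three cases
        remain.\<close>
      have u: "v = \<pi> u \<and> v \<in> P" if "u \<notin> P" using \<pi>[of u] that V im(1) by simp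
      have v: "u = \<pi> v \<and> u \<in> P" if "v \<notin> P" using \<pi>[of v] that V im(2) by simp
      consider "u \<in> P" "v \<in> P" | "u \<notin> P" "v = \<pi> u" "v \<in> P" | "v \<notin> P" "u = \<pi> v" "u \<in> P"
        using u v by blast
      then show "(z, w) \<in> parcs ?C"
      proof cases
        case 1
        then have "z = Inl u" "w = Inl v" using uv by (simp_all add: \<phi>_def)
        then show ?thesis using 1 uv by (simp add: corona_def)
      next
        case 2
        then have "z = Inr (v, \<beta> v u)" "w = Inl v" using uv by (simp_all add: \<phi>_def)
        moreover have "\<beta> v u < m" using leafin[of u] 2 V by simp
        ultimately show ?thesis using 2(3) by (simp add: corona_def edgeless_graph_def)
      next
        case 3
        then have "z = Inl u" "w = Inr (u, \<beta> u v)" using uv by (simp_all add: \<phi>_def)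
        moreover have "\<beta> u v < m" using leafin[of v] 3 V by simp
        ultimately show ?thesis using 3(3) by (simp add: corona_def edgeless_graph_def)
      qed
    qed
    then show ?thesis by (simp only: Pair)
  qed
  then have "parcs ?C = map_prod \<phi> \<phi> ` parcs G" by (rule set_eqI)
  with inj pv show ?thesis
    using digraph_iso_with_proj_iff[OF pair_wf_digraph_axioms] by blast
qed

section \<open>The bound and its extremal graphs\<close>

text \<open>Equality with a corona is read as isomorphism. The characterization is stated for
  nonempty graphs: the empty graph attains the bound with both sides 0, while p > 0 makes each of
  the coronas nonempty.\<close>

theorem theorem3p2:
  fixes G :: "'a pair_pre_digraph" and r n :: nat
  assumes "2 \<le> r"
    and "pair_graph G"
    and "clique_free (r + 1) G"
    and "card (pverts G) = n"
  shows "real_of_int (nnsd_number G)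
           \<ge> - (2 * real r / (real r - 1))
             + 2 / (real r - 1) * sqrt ((real r)\<^sup>2 + real r * (real r - 1) * real n) - real n
       \<and> (pverts G \<noteq> {} \<longrightarrow>
           (real_of_int (nnsd_number G)
              = - (2 * real r / (real r - 1))
                + 2 / (real r - 1) * sqrt ((real r)\<^sup>2 + real r * (real r - 1) * real n) - real n
            \<longleftrightarrow> (\<exists>p > 0. \<exists>H :: 'a pair_pre_digraph.
                  balanced_complete_partite r p H \<and>
                  digraph_iso (with_proj G) (with_proj (corona H (edgeless_graph ((r - 1) * p + 1)))))))"
    (is "?N \<ge> ?B \<and> (_ \<longrightarrow> (_ \<longleftrightarrow> ?E))")
proof -
  interpret pair_graph G by fact
  note G = assms(2)
  \<comment> \<open>Writing r = k + 1 avoids truncated subtraction and matches the parameter of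
    \<open>turan\<close>: forbidden cliques have k + 2 vertices.\<close>
  obtain k where k: "r = k + 1"
    using assms(1) by (intro that[of "r - 1"]) auto
  have r1: "1 < real r" using assms(1) by simp
  \<comment> \<open>The real estimate in terms of natural numbers, for arbitrary \<open>a\<close>:
    it is applied to the positive vertices of a minimum function and, for the converse, to the order
    of \<open>H\<close>.\<close>
  have sqrt: "?B \<le> 2 * real a - real n"
      "?B = 2 * real a - real n \<longleftrightarrow> r * n = k * a\<^sup>2 + 2 * r * a"
    if "r * n \<le> k * a\<^sup>2 + 2 * r * a" for a
  proof -
    have "real (r * n) \<le> real (k * a\<^sup>2 + 2 * r * a)" using that by (rule of_nat_mono)
    then have le: "real r * real n \<le> (real r - 1) * (real a)\<^sup>2 + 2 * real r * real a"
      by (simp add: k algebra_simps)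
    show "?B \<le> 2 * real a - real n"
      by (rule sqrt_bound(1)[OF r1 _ _ le]) auto
    have "?B = 2 * real a - real n \<longleftrightarrow>
        real r * real n = (real r - 1) * (real a)\<^sup>2 + 2 * real r * real a"
      by (rule sqrt_bound(2)[OF r1 _ _ le]) auto
    also have "\<dots> \<longleftrightarrow> real (r * n) = real (k * a\<^sup>2 + 2 * r * a)" by (simp add: k algebra_simps)
    also have "\<dots> \<longleftrightarrow> r * n = k * a\<^sup>2 + 2 * r * a" by (rule of_nat_eq_iff)
    finally show "?B = 2 * real a - real n \<longleftrightarrow> r * n = k * a\<^sup>2 + 2 * r * a" .
  qed
  obtain f where f: "nnsdf G f" "nnsd_number G = sum f (pverts G)"
    using nnsd_number_attained[OF G] by blast
  define P where "P = {v \<in> pverts G. f v = 1}"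
  define M where "M = {v \<in> pverts G. f v \<noteq> 1}"
  define D where "D = (\<Sum>u\<in>P. card (parcs G `` {u} \<inter> P))"
  define a where "a = card P"
  have finP: "finite P" and PV: "P \<subseteq> pverts G" using pair_finite_verts by (auto simp: P_def)
  have N: "?N = 2 * real a - real n"
    using nnsdf_weight[OF G f(1)] f(2) assms(4) by (simp add: a_def P_def)
  have nD: "n \<le> D + 2 * a"
    using nnsdf_order_le[OF G f(1)] assms(4) by (simp add: a_def P_def D_def)
  have K: "\<forall>K\<subseteq>P. card K = k + 2 \<longrightarrow> \<not> pairwise (\<lambda>x y. (x, y) \<in> parcs G) K"
    using clique_freeD[OF assms(3) G] PV k by auto
  note T = turan[OF finP pair_graph_sym_parcs[OF G] pair_graph_irrefl_parcs[OF G] K,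
      folded D_def a_def k]
  have "r * n \<le> r * D + 2 * r * a"
    using mult_le_mono2[OF nD, of r] by (simp add: algebra_simps)
  then have rn: "r * n \<le> k * a\<^sup>2 + 2 * r * a" using T by linarith
  have lower: "?N \<ge> ?B" using sqrt(1)[OF rn] N by simp
  moreover have "?E" if eq: "?N = ?B" and ne: "pverts G \<noteq> {}"
  proof -
    have rne: "r * n = k * a\<^sup>2 + 2 * r * a" using sqrt(2)[OF rn] eq N by simp
    \<comment> \<open>r n lies below r D + 2 r a, which Turan's bound puts below k a^2 + 2 r a;
      equality of the ends forces equality in Turan's bound.\<close>
    have Deq: "r * D = k * a\<^sup>2"
      using T rne \<open>r * n \<le> r * D + 2 * r * a\<close> by linarith
    have "r * n = r * (D + 2 * a)" using rne Deq by (simp add: algebra_simps)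
    then have nDe: "card (pverts G) = D + 2 * card P" using assms(1,4) by (simp add: a_def)
    have one: "card (parcs G `` {v} \<inter> P) = 1" if "v \<in> M" for v
      using nnsdf_order_eq(1)[OF G f(1)] nDe that by (simp add: P_def M_def D_def)
    have deg: "card (parcs G `` {u} \<inter> M) = card (parcs G `` {u} \<inter> P) + 1" if "u \<in> P" for u
      using nnsdf_order_eq(2)[OF G f(1)] nDe that by (simp add: P_def M_def D_def)
    \<comment> \<open>With exactly one positive neighbour there is no room for a negative one, so
      the vertices of \<open>M\<close> are leaves.\<close>
    have none: "parcs G `` {v} \<inter> M = {}" if "v \<in> M" for v
    proof -
      have "card (parcs G `` {v} \<inter> M) + 1 \<le> card (parcs G `` {v} \<inter> P)"
        using nnsdf_neg[OF G f(1)] that by (simp add: P_def M_def)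
      then have "card (parcs G `` {v} \<inter> M) = 0" using one[OF that] by simp
      then show ?thesis using pair_finite_verts by (auto simp: M_def)
    qed
    have NV: "parcs G `` {v} \<subseteq> P \<union> M" for v by (auto simp: P_def M_def dest: wellformed')
    \<comment> \<open>If \<open>P\<close> were empty, then D = 0 and \<open>nDe\<close> would leave
      \<open>G\<close> without vertices. Nonemptiness gives access to the equality case of
      \<open>turan\<close>.\<close>
    have Pne: "P \<noteq> {}" using nDe ne pair_finite_verts by (auto simp: D_def)
    with T Deq obtain Q where Q: "partition_on P Q" "card Q = r" "\<forall>A\<in>Q. r * card A = a"
        "\<forall>u\<in>P. \<forall>v\<in>P. (u, v) \<in> parcs G \<longleftrightarrow> \<not> (\<exists>A\<in>Q. u \<in> A \<and> v \<in> A)" by blast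
    \<comment> \<open>The division is exact, since r |A| = a for every part A.\<close>
    define p where "p = a div r"
    have p: "card A = p" if "A \<in> Q" for A using Q(3) that assms(1) unfolding p_def by force
    define H where "H = \<lparr>pverts = P, parcs = parcs G \<inter> P \<times> P\<rparr>"
    have "pair_graph H"
    proof
      show "finite (parcs H)" using pair_finite_arcs by (simp add: H_def)
      show "symmetric (with_proj H)"
        using pair_graph_sym_parcs[OF G] by (auto simp: H_def symmetric_def sym_def)
    qed (use finP pair_no_loops in \<open>auto simp: H_def\<close>)
    then have "complete_multipartite H Q"
      using Q by (auto simp: complete_multipartite_def H_def)
    then have H: "balanced_complete_partite r p H"
      using Q p by (auto simp: balanced_complete_partite_def)
    have "digraph_iso (with_proj G) (with_proj (corona H (edgeless_graph ((r - 1) * p + 1))))"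
      unfolding H_def
    proof (rule corona_iso[OF G PV])
      fix v assume "v \<in> pverts G - P"
      then have v: "v \<in> M" by (auto simp: P_def M_def)
      from one[OF v] obtain u where u: "parcs G `` {v} \<inter> P = {u}" by (auto simp: card_1_singleton_iff)
      moreover have "parcs G `` {v} = {u}" using u none[OF v] NV[of v] by blast
      ultimately show "\<exists>u\<in>P. parcs G `` {v} = {u}" by blast
    next
      fix u assume u: "u \<in> P"
      \<comment> \<open>The leaves at \<open>u\<close> are its negative neighbours, one more than
        its degree (r - 1) p in \<open>H\<close>.\<close>
      have "parcs G `` {u} - P = parcs G `` {u} \<inter> M" using NV[of u] by (auto simp: P_def M_def)
      moreover have "nbhd H u = parcs G `` {u} \<inter> P" using u by (auto simp: nbhd_def H_def)
      ultimately show "card (parcs G `` {u} - P) = (r - 1) * p + 1"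
        using deg[OF u] balanced_complete_partite_degree[OF H, of u] u by (simp add: H_def)
    qed
    moreover have "p > 0"
    proof -
      have "a = r * p" using balanced_complete_partite_card[OF H] by (simp add: H_def a_def)
      then show ?thesis using Pne finP by (auto simp: a_def card_gt_0_iff intro: Suc_leI)
    qed
    ultimately show ?E using H by blast
  qed
  \<comment> \<open>The canonical function on the corona has weight 2b - n with b = r p, which
    bounds ?N from above; for this \<open>b\<close> the quadratic inequality is an equality, so the
    weight is ?B and meets the lower bound.\<close>
  moreover have "?N = ?B" if "?E"
  proof -
    from that obtain p and H :: "'a pair_pre_digraph" where H: "balanced_complete_partite r p H"
      and iso: "digraph_iso (with_proj G) (with_proj (corona H (edgeless_graph ((r - 1) * p + 1))))" by blast
    from iso[unfolded digraph_iso_with_proj_iff[OF pair_wf_digraph_axioms]] obtain \<phi> where \<phi>: "inj_on \<phi> (pverts G)"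
        "pverts (corona H (edgeless_graph ((r - 1) * p + 1))) = \<phi> ` pverts G"
        "parcs (corona H (edgeless_graph ((r - 1) * p + 1))) = map_prod \<phi> \<phi> ` parcs G"
      by blast
    have Hg: "pair_graph H"
      using H by (auto simp: balanced_complete_partite_def complete_multipartite_def)
    then interpret H: pair_graph H .
    let ?m = "(r - 1) * p + 1" and ?g = "case_sum (\<lambda>_. 1) (\<lambda>_. -1) :: 'a + 'a \<times> nat \<Rightarrow> int"
    define b where "b = r * p"
    have cH: "card (pverts H) = b" using balanced_complete_partite_card[OF H] by (simp add: b_def)
    have "nnsdf (corona H (edgeless_graph ?m)) ?g"
      by (rule corona_nnsdf[OF Hg]) (simp add: balanced_complete_partite_degree[OF H])
    then have "nnsdf G (?g \<circ> \<phi>)" by (rule nnsdf_pullback[OF pair_wf_digraph_axioms \<phi>])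
    then have "nnsd_number G \<le> sum (?g \<circ> \<phi>) (pverts G)" by (rule nnsd_number_le[OF G])
    also have "\<dots> = sum ?g (pverts (corona H (edgeless_graph ?m)))"
      unfolding \<phi>(2) by (rule sum.reindex[OF \<phi>(1), symmetric])
    also have "\<dots> = int b - int (b * ?m)" by (simp only: sum_corona[OF H.pair_finite_verts] cH)
    finally have le: "nnsd_number G \<le> int b - int (b * ?m)" .
    have nb: "n = b + b * ?m"
      using card_image[OF \<phi>(1)] assms(4) card_corona[OF H.pair_finite_verts, of ?m] cH \<phi>(2) by simp
    \<comment> \<open>Here n = b (k p + 2), and r p = b turns r b k p into k b^2.\<close>
    have "r * n = k * b\<^sup>2 + 2 * r * b"
      unfolding nb by (simp add: b_def k power2_eq_square algebra_simps)
    then have "?B = 2 * real b - real n" using sqrt[of b] by simp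
    also have "\<dots> = of_int (int b - int (b * ?m))" by (simp add: nb)
    also have "\<dots> \<ge> ?N" using le by (simp only: of_int_le_iff)
    finally show ?thesis using lower by linarith
  qed
  ultimately show ?thesis by blast
qed

end
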